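(* Let a circulant $n\times n$ matrix function $F(x)$ satisfy $$F(x+\omega^m y)=\Omega^{-m}F(y)\,\Omega^{m}F(x)$$ (for all $x,y\in\mathbb{C}$) for a fixed value of $m\in\{0,1,\dots,n-1\}$, and let $d=\gcd(n,m)$. Then $F(x)=\mathrm{circ}(\mathbf f(x)^T)$ where $$\mathbf f(x)=\frac{1}{\sqrt n}\,\mathcal F\begin{bmatrix}\mathbf h(x)\\ \mathbf h(\omega^{m}x)\\ \vdots\\ \mathbf h(\omega^{m(n/d-1)}x)\end{bmatrix},$$ $\mathbf h(x)$ being an arbitrary $d$-tuple of exponential functions. In particular, when $d=1$, $$\mathbf f(x)=\frac{1}{\sqrt n}\,\mathcal F\begin{bmatrix} g(x)\\ g(\omega x)\\ \vdots\\ g(\omega^{n-1}x)\end{bmatrix},$$ where $g$ is an arbitrary exponential function.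
   Context: Here $n\ge 2$ is a fixed integer and $\omega=e^{2\pi i/n}$. All functions are complex-valued functions of a complex variable; no assumption is made about the entries of $F$ beyond $F(x)$ being circulant for each $x$. Matrix and vector indices run over $0,\dots,n-1$. $\mathcal F$ is the $n\times n$ Fourier matrix with $(j,k)$ entry $\frac{1}{\sqrt n}\omega^{-jk}$, and $\Omega=\mathrm{diag}[1,\omega,\dots,\omega^{n-1}]$. For a column vector $\mathbf a=(a_0,\dots,a_{n-1})^T$, $\mathrm{circ}(\mathbf a^T)$ is the $n\times n$ circulant matrix with first row $(a_0,\dots,a_{n-1})$, whose $(j,k)$ entry is $a_{(k-j)\bmod n}$. When $m=0$, $\gcd(n,m)=n$. The $d$-tuple $\mathbf h(x)$ is regarded as a column of length $d$, and the column on which $\mathcal F$ acts is formed by stacking the $n/d$ blocks $\mathbf h(\omega^{mj}x)$, $j=0,1,\dots,n/d-1$. An exponential function is a function $f:\mathbb{C}\to\mathbb{C}$ satisfying $f(x+y)=f(x)f(y)$ for all $x,y$ (continuity is not assumed, and the zero function is allowed).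
   Formalization: The general formula is proved with blocks h(ω^{dj}x), d = gcd(n,m), instead of h(ω^{mj}x); the printed order is false if m≠0 does not divide n (n=3, m=2, eigenvalues exp(ω^j x)). It is proved as printed for m=0 or m|n; the d=1 formula is unchanged. *)

theory Defs
  imports Complex_Main "Jordan_Normal_Form.Matrix"
begin

definition omega :: "nat \<Rightarrow> complex" where
  "omega n = exp (2 * complex_of_real pi * \<i> / of_nat n)"

definition fourier_mat :: "nat \<Rightarrow> complex mat" where
  "fourier_mat n = mat n n (\<lambda>(j, k). complex_of_real (1 / sqrt (real n)) * omega n powi (- int (j * k)))"

definition Omega :: "nat \<Rightarrow> complex mat" where
  "Omega n = mat_diag n (\<lambda>j. omega n ^ j)"

definition Omega_inv :: "nat \<Rightarrow> complex mat" where
  "Omega_inv n = mat_diag n (\<lambda>j. inverse (omega n ^ j))"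

lemma Omega_inv_inverts: "inverts_mat (Omega_inv n) (Omega n)" "inverts_mat (Omega n) (Omega_inv n)"
  by (simp_all add: inverts_mat_def Omega_def Omega_inv_def omega_def)
     (simp_all add: mat_diag_def)

text \<open>The matrix with first row \<open>a\<close>. The index is \<open>(k - j) mod dim_vec a\<close>; adding
  \<open>dim_vec a\<close> avoids truncated subtraction.\<close>

definition circ :: "complex vec \<Rightarrow> complex mat" where
  "circ a = mat (dim_vec a) (dim_vec a) (\<lambda>(j, k). a $ ((k + dim_vec a - j) mod dim_vec a))"

definition circulant :: "nat \<Rightarrow> complex mat \<Rightarrow> bool" where
  "circulant n A \<longleftrightarrow> (\<exists>a \<in> carrier_vec n. A = circ a)"

definition exponential_function :: "(complex \<Rightarrow> complex) \<Rightarrow> bool" where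
  "exponential_function f \<longleftrightarrow> (\<forall>x y. f (x + y) = f x * f y)"

definition satisfies_equation :: "nat \<Rightarrow> nat \<Rightarrow> (complex \<Rightarrow> complex mat) \<Rightarrow> bool" where
  "satisfies_equation n m F \<longleftrightarrow>
     (\<forall>x y. F (x + omega n ^ m * y) = Omega_inv n ^\<^sub>m m * F y * Omega n ^\<^sub>m m * F x)"

text \<open>The column obtained by stacking the blocks \<open>b 0, \<dots>, b (q - 1)\<close>, each of length \<open>d\<close>.\<close>

definition stack :: "nat \<Rightarrow> nat \<Rightarrow> (nat \<Rightarrow> complex vec) \<Rightarrow> complex vec" where
  "stack q d b = vec (q * d) (\<lambda>p. b (p div d) $ (p mod d))"

text \<open>The blocks are \<open>h (c ^ j * x)\<close> for \<open>j < n div d\<close>, where only \<open>h 0, \<dots>, h (d - 1)\<close> matter.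
  The multiplier \<open>c\<close> is \<open>omega n ^ gcd n m\<close> in general. Since \<open>omega n ^ m\<close> generates the same
  group of roots of unity as \<open>omega n ^ gcd n m\<close>, using \<open>omega n ^ m\<close> instead gives the same
  blocks in a permuted order; that order solves the functional equation for all \<open>h\<close> only if
  \<open>m = 0\<close> or \<open>m\<close> divides \<open>n\<close>. For example, if \<open>n = 3\<close> and \<open>m = 2\<close>, the solutions
  have eigenvalues \<open>g (omega 3 ^ j * x)\<close>, not \<open>g (omega 3 ^ (2 * j) * x)\<close>, at index \<open>j\<close>.\<close>

definition first_row ::
  "nat \<Rightarrow> nat \<Rightarrow> complex \<Rightarrow> (nat \<Rightarrow> complex \<Rightarrow> complex) \<Rightarrow> complex \<Rightarrow> complex vec" where
  "first_row n d c h x =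
     complex_of_real (1 / sqrt (real n)) \<cdot>\<^sub>v
       (fourier_mat n *\<^sub>v stack (n div d) d (\<lambda>j. vec d (\<lambda>i. h i (c ^ j * x))))"

end

theory Submission
  imports Defs
begin

text \<open>All circulants are diagonalised by the same Fourier basis, and conjugation by \<open>Omega n ^ m\<close>
  shifts the spectrum by \<open>m\<close>. Hence the matrix equation says that the eigenvalues \<open>L p\<close> of \<open>F\<close>
  satisfy \<open>L p (x + w ^ m * y) = L (p + m) y * L p x\<close>, where \<open>w = omega n\<close> and indices are
  modulo \<open>n\<close>. If \<open>L p\<close> is not identically zero, then setting \<open>y = 0\<close> gives \<open>L (p + m) 0 = 1\<close>;
  so along each cycle \<open>p, p + m, p + 2 m, \<dots>\<close> either all \<open>L\<close> vanish identically or all take the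
  value 1 at 0. In both cases \<open>L (p + m) y = L p (w ^ m * y)\<close>, so every \<open>L p\<close> is exponential, and
  by Bezout \<open>L (p + d) y = L p (w ^ d * y)\<close> for \<open>d = gcd n m\<close>. Thus \<open>L 0, \<dots>, L (d - 1)\<close>
  determine all eigenvalues, and they can be prescribed freely.\<close>

section \<open>Roots of unity and orthogonality of characters\<close>

lemma omega_nonzero [simp]: "omega n \<noteq> 0"
  by (simp add: omega_def)

lemma omega_power_eq_cis: "omega n ^ k = cis (2 * pi * real k / real n)"
proof -
  have "omega n = cis (2 * pi / real n)"
    by (simp add: omega_def cis_conv_exp mult.commute)
  then show ?thesis
    by (simp add: DeMoivre mult_ac)
qed

lemma omega_power_self [simp]: "n > 0 \<Longrightarrow> omega n ^ n = 1"
  by (simp add: omega_power_eq_cis)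

lemma omega_power_mod: "n > 0 \<Longrightarrow> omega n ^ (k mod n) = omega n ^ k"
proof -
  assume "n > 0"
  have "omega n ^ k = omega n ^ (n * (k div n) + k mod n)"
    by simp
  also have "\<dots> = omega n ^ (k mod n)"
    using \<open>n > 0\<close> by (simp only: power_add power_mult omega_power_self power_one mult_1)
  finally show ?thesis by simp
qed

lemma omega_power_inj:
  assumes "j < n" "k < n" "omega n ^ j = omega n ^ k"
  shows "j = k"
proof -
  have "inj_on (\<lambda>k. cis (2 * pi * real k / real n)) {..<n}"
    using bij_betw_roots_unity[of n] assms(1) by (auto simp: bij_betw_def)
  then show ?thesis
    using assms by (auto simp: inj_on_def omega_power_eq_cis)
qed

text \<open>The summands are powers of \<open>omega n ^ j / omega n ^ l\<close>, an n-th root of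
  unity that equals 1 only for \<open>j = l\<close>; otherwise the geometric sum vanishes.\<close>

lemma omega_orthogonality:
  assumes "j < n" "l < n"
  shows "(\<Sum>k<n. omega n ^ (j * k) * inverse (omega n ^ (k * l))) = (if j = l then of_nat n else 0)"
proof -
  let ?z = "omega n ^ j / omega n ^ l"
  have summand: "omega n ^ (j * k) * inverse (omega n ^ (k * l)) = ?z ^ k" for k
    by (simp add: power_mult power_divide field_simps flip: power_mult)
  have "?z ^ n = (omega n ^ n) ^ j / (omega n ^ n) ^ l"
    by (simp add: power_divide mult.commute flip: power_mult)
  then have "?z ^ n = 1" using assms by simp
  moreover have "?z \<noteq> 1" if "j \<noteq> l"
    using omega_power_inj[OF assms] that by auto
  ultimately show ?thesis
    by (simp add: summand sum_gp_strict)
qed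

text \<open>Column \<open>k\<close> is the eigenvector common to all circulants that belongs to the character \<open>k + m\<close>.\<close>

definition char_mat :: "nat \<Rightarrow> nat \<Rightarrow> complex mat" where
  "char_mat n m = mat n n (\<lambda>(j, k). omega n ^ (j * (k + m)))"

text \<open>Only row 0 is read, so this is an eigenvalue when \<open>A\<close> is circulant. The
  index \<open>p\<close> is any natural number, so that \<open>p + m\<close> needs no reduction
  modulo \<open>n\<close>.\<close>

definition circ_eig :: "nat \<Rightarrow> complex mat \<Rightarrow> nat \<Rightarrow> complex" where
  "circ_eig n A p = (\<Sum>k<n. A $$ (0, k) * omega n ^ (p * k))"

section \<open>Invertibility of the Fourier basis\<close>

lemma char_mat_carrier [simp]: "char_mat n m \<in> carrier_mat n n"
  by (simp add: char_mat_def)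

lemma fourier_mat_carrier [simp]: "fourier_mat n \<in> carrier_mat n n"
  by (simp add: fourier_mat_def)

lemma circ_carrier: "a \<in> carrier_vec n \<Longrightarrow> circ a \<in> carrier_mat n n"
  by (auto simp: circ_def)

lemma circulant_carrier: "circulant n A \<Longrightarrow> A \<in> carrier_mat n n"
  by (auto simp: circulant_def circ_carrier)

lemma circulant_circ: "a \<in> carrier_vec n \<Longrightarrow> circulant n (circ a)"
  by (auto simp: circulant_def)

lemma char_mat_mult_fourier_mat:
  "char_mat n 0 * fourier_mat n = complex_of_real (sqrt (real n)) \<cdot>\<^sub>m 1\<^sub>m n"
proof (rule eq_matI)
  fix j l
  assume "j < dim_row (complex_of_real (sqrt (real n)) \<cdot>\<^sub>m 1\<^sub>m n)"
    and "l < dim_col (complex_of_real (sqrt (real n)) \<cdot>\<^sub>m 1\<^sub>m n)"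
  then have jl: "j < n" "l < n" by simp_all
  have "(char_mat n 0 * fourier_mat n) $$ (j, l)
      = (\<Sum>k<n. omega n ^ (j * k) * (omega n powi (- int (k * l)) / complex_of_real (sqrt (real n))))"
    using jl by (simp add: char_mat_def fourier_mat_def scalar_prod_def atLeast0LessThan)
  also have "\<dots> = (\<Sum>k<n. omega n ^ (j * k) * inverse (omega n ^ (k * l))) / complex_of_real (sqrt (real n))"
    by (simp only: power_int_minus power_int_of_nat sum_divide_distrib times_divide_eq_right)
  also have "\<dots> = (if j = l then complex_of_real (real n / sqrt (real n)) else 0)"
    by (simp add: omega_orthogonality[OF jl])
  finally show "(char_mat n 0 * fourier_mat n) $$ (j, l)
      = (complex_of_real (sqrt (real n)) \<cdot>\<^sub>m 1\<^sub>m n) $$ (j, l)"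
    using jl by (simp add: real_div_sqrt)
qed (simp_all add: char_mat_def fourier_mat_def)

text \<open>Both factors are symmetric, so transposing the product in the other order
  suffices.\<close>

lemma fourier_mat_mult_char_mat:
  "fourier_mat n * char_mat n 0 = complex_of_real (sqrt (real n)) \<cdot>\<^sub>m 1\<^sub>m n"
proof -
  have "transpose_mat (char_mat n 0) = char_mat n 0" "transpose_mat (fourier_mat n) = fourier_mat n"
    by (auto simp: char_mat_def fourier_mat_def mult.commute)
  then have "fourier_mat n * char_mat n 0 = transpose_mat (char_mat n 0 * fourier_mat n)"
    using transpose_mult[OF char_mat_carrier[of n 0] fourier_mat_carrier[of n]] by simp
  then show ?thesis
    by (simp add: char_mat_mult_fourier_mat) (auto intro!: eq_matI)
qed

lemma char_mat_cancel_right: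
  assumes "A \<in> carrier_mat n n" "B \<in> carrier_mat n n" "n > 0"
    and "A * char_mat n 0 = B * char_mat n 0"
  shows "A = B"
proof -
  have cancel: "M = (1 / complex_of_real (sqrt (real n))) \<cdot>\<^sub>m (M * char_mat n 0 * fourier_mat n)"
    if M: "M \<in> carrier_mat n n" for M
  proof -
    have "M * char_mat n 0 * fourier_mat n = M * (char_mat n 0 * fourier_mat n)"
      by (rule assoc_mult_mat[OF M char_mat_carrier fourier_mat_carrier])
    also have "\<dots> = complex_of_real (sqrt (real n)) \<cdot>\<^sub>m M"
      using M by (simp add: char_mat_mult_fourier_mat mult_smult_distrib[OF M one_carrier_mat])
    finally show ?thesis
      using M assms(3) by (intro eq_matI) auto
  qed
  show ?thesis
    using cancel[OF assms(1)] cancel[OF assms(2)] assms(4) by simp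
qed

lemma char_mat_cancel_left:
  assumes "A \<in> carrier_mat n n" "B \<in> carrier_mat n n" "n > 0"
    and "char_mat n 0 * A = char_mat n 0 * B"
  shows "A = B"
proof -
  have cancel: "M = (1 / complex_of_real (sqrt (real n))) \<cdot>\<^sub>m (fourier_mat n * (char_mat n 0 * M))"
    if M: "M \<in> carrier_mat n n" for M
  proof -
    have "fourier_mat n * (char_mat n 0 * M) = fourier_mat n * char_mat n 0 * M"
      by (rule assoc_mult_mat[OF fourier_mat_carrier char_mat_carrier M, symmetric])
    also have "\<dots> = complex_of_real (sqrt (real n)) \<cdot>\<^sub>m M"
      using M by (simp add: fourier_mat_mult_char_mat mult_smult_assoc_mat[of _ n n _ n])
    finally show ?thesis
      using M assms(3) by (intro eq_matI) auto
  qed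
  show ?thesis
    using cancel[OF assms(1)] cancel[OF assms(2)] assms(4) by simp
qed

section \<open>Diagonal matrices and the spectrum of circulants\<close>

lemma mat_diag_carrier [simp]: "mat_diag n f \<in> carrier_mat n n"
  by (simp add: mat_diag_def)

lemma mat_diag_eq_iff: "mat_diag n f = mat_diag n g \<longleftrightarrow> (\<forall>p<n. f p = g p)"
proof
  assume eq: "mat_diag n f = mat_diag n g"
  show "\<forall>p<n. f p = g p"
  proof (intro allI impI)
    fix p assume "p < n"
    then show "f p = g p"
      using arg_cong[OF eq, of "\<lambda>A. A $$ (p, p)"] by (simp add: mat_diag_def)
  qed
qed (auto simp: mat_diag_def)

lemma mat_diag_power: "mat_diag n f ^\<^sub>m m = mat_diag n (\<lambda>j. (f j :: complex) ^ m)"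
proof (induction m)
  case 0
  show ?case by (auto simp: mat_diag_def)
next
  case (Suc m)
  then show ?case by (simp add: mat_diag_diag mult.commute)
qed

lemma circ_eig_circ:
  assumes "a \<in> carrier_vec n"
  shows "circ_eig n (circ a) p = (\<Sum>k<n. a $ k * omega n ^ (p * k))"
  using assms by (auto simp: circ_eig_def circ_def intro!: sum.cong)

lemma sum_cyclic_shift:
  fixes f :: "nat \<Rightarrow> 'a::comm_monoid_add"
  assumes "j < n"
  shows "(\<Sum>k<n. f ((k + n - j) mod n)) = (\<Sum>k<n. f k)"
proof (rule sum.reindex_bij_witness[where i = "\<lambda>k. (k + j) mod n" and j = "\<lambda>k. (k + n - j) mod n"])
  fix k assume k: "k \<in> {..<n}"
  have "((k + n - j) mod n + j) mod n = (k + n) mod n"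
    using assms by (simp add: mod_add_left_eq)
  then show "((k + n - j) mod n + j) mod n = k"
    using k by simp
  show "((k + j) mod n + n - j) mod n = k"
  proof -
    have "((k + j) mod n + n - j) mod n = ((k + j) mod n + (n - j)) mod n"
      using assms by simp
    also have "\<dots> = (k + j + (n - j)) mod n"
      by (rule mod_add_left_eq)
    also have "\<dots> = k" using assms k by simp
    finally show ?thesis .
  qed
qed (use assms in auto)

text \<open>Row \<open>j\<close> of a circulant is row 0 shifted by \<open>j\<close>; undoing the
  shift in the sum pulls out the character value at \<open>j\<close>. The offset \<open>m\<close> is
  kept general because conjugation by \<open>Omega n ^\<^sub>m m\<close> leads to the basis
  \<open>char_mat n m\<close>.\<close>

lemma circulant_mult_char_mat:
  assumes "circulant n A"
  shows "A * char_mat n m = char_mat n m * mat_diag n (\<lambda>p. circ_eig n A (p + m))"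
proof -
  obtain a where a: "a \<in> carrier_vec n" and A: "A = circ a"
    using assms by (auto simp: circulant_def)
  show ?thesis
  proof (rule eq_matI)
    fix j p
    assume "j < dim_row (char_mat n m * mat_diag n (\<lambda>p. circ_eig n A (p + m)))"
      and "p < dim_col (char_mat n m * mat_diag n (\<lambda>p. circ_eig n A (p + m)))"
    then have jp: "j < n" "p < n" by (simp_all add: char_mat_def mat_diag_def)
    \<comment> \<open>The index \<open>(k + n - j) mod n\<close> is congruent to
      \<open>k - j\<close>, and powers of \<open>omega n\<close> see exponents only modulo
      \<open>n\<close>.\<close>
    have shift: "omega n ^ (k * (p + m))
        = omega n ^ (j * (p + m)) * omega n ^ ((p + m) * ((k + n - j) mod n))" for k
    proof -
      have "omega n ^ (j * (p + m)) * omega n ^ ((p + m) * ((k + n - j) mod n))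
          = (omega n ^ j * omega n ^ ((k + n - j) mod n)) ^ (p + m)"
        by (simp only: power_mult_distrib mult.commute flip: power_mult)
      also have "omega n ^ j * omega n ^ ((k + n - j) mod n) = omega n ^ (k + n)"
        using jp by (simp add: omega_power_mod flip: power_add)
      also have "\<dots> = omega n ^ k"
        using jp by (simp add: power_add)
      finally show ?thesis
        by (simp add: power_mult)
    qed
    have "(A * char_mat n m) $$ (j, p)
        = (\<Sum>k<n. a $ ((k + n - j) mod n) * omega n ^ (k * (p + m)))"
      using a jp by (simp add: A circ_def char_mat_def scalar_prod_def atLeast0LessThan)
    also have "\<dots> = omega n ^ (j * (p + m)) *
        (\<Sum>k<n. a $ ((k + n - j) mod n) * omega n ^ ((p + m) * ((k + n - j) mod n)))"
      by (subst shift) (simp add: sum_distrib_left mult_ac)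
    also have "\<dots> = omega n ^ (j * (p + m)) * circ_eig n A (p + m)"
      by (simp only: A circ_eig_circ[OF a]
          sum_cyclic_shift[OF jp(1), where f = "\<lambda>k. a $ k * omega n ^ ((p + m) * k)"])
    finally show "(A * char_mat n m) $$ (j, p)
        = (char_mat n m * mat_diag n (\<lambda>p. circ_eig n A (p + m))) $$ (j, p)"
      using jp by (simp add: mat_diag_mult_right[OF char_mat_carrier]) (simp add: char_mat_def)
  qed (use a in \<open>auto simp: A circ_def char_mat_def mat_diag_def\<close>)
qed

lemma circulant_eqI:
  assumes "circulant n A" "circulant n B" "n > 0" "\<And>p. p < n \<Longrightarrow> circ_eig n A p = circ_eig n B p"
  shows "A = B"
proof (rule char_mat_cancel_right)
  have "mat_diag n (circ_eig n A) = mat_diag n (circ_eig n B)"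
    using assms(4) by (simp add: mat_diag_eq_iff)
  then show "A * char_mat n 0 = B * char_mat n 0"
    using circulant_mult_char_mat[OF assms(1), of 0] circulant_mult_char_mat[OF assms(2), of 0]
    by simp
qed (use assms in \<open>auto intro: circulant_carrier\<close>)

lemma circ_eig_add_period [simp]: "n > 0 \<Longrightarrow> circ_eig n A (p + n) = circ_eig n A p"
  by (simp add: circ_eig_def add_mult_distrib power_add power_mult)

lemma circ_eig_mod: "n > 0 \<Longrightarrow> circ_eig n A (p mod n) = circ_eig n A p"
proof -
  assume "n > 0"
  then have "omega n ^ ((p mod n) * k) = omega n ^ (p * k)" for k
    by (simp only: power_mult omega_power_mod)
  then show ?thesis by (simp add: circ_eig_def)
qed

section \<open>From the matrix equation to the eigenvalues\<close>

lemma Omega_power_mult_char_mat: "Omega n ^\<^sub>m m * char_mat n 0 = char_mat n m"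
  unfolding Omega_def mat_diag_power mat_diag_mult_left[OF char_mat_carrier]
  by (intro eq_matI) (auto simp: char_mat_def distrib_left power_add power_mult)

lemma Omega_inv_power_mult_char_mat: "Omega_inv n ^\<^sub>m m * char_mat n m = char_mat n 0"
  unfolding Omega_inv_def mat_diag_power mat_diag_mult_left[OF char_mat_carrier]
  by (intro eq_matI) (auto simp: char_mat_def distrib_left power_add power_mult power_inverse)

text \<open>Multiply on the right by \<open>char_mat n 0\<close> and carry this basis leftwards: a
  circulant leaves a diagonal factor behind, the power of \<open>Omega\<close> changes the basis to
  \<open>char_mat n m\<close>, and that of \<open>Omega_inv\<close> changes it back. Cancelling the
  basis leaves an equation of diagonal matrices.\<close>

lemma satisfies_equation_iff_circ_eig:
  assumes n: "n > 0" and F: "\<forall>x. circulant n (F x)"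
  shows "satisfies_equation n m F \<longleftrightarrow>
    (\<forall>x y p. circ_eig n (F (x + omega n ^ m * y)) p = circ_eig n (F y) (p + m) * circ_eig n (F x) p)"
proof -
  let ?E = "char_mat n 0" and ?D = "\<lambda>x m. mat_diag n (\<lambda>p. circ_eig n (F x) (p + m))"
  let ?U = "Omega n ^\<^sub>m m" and ?V = "Omega_inv n ^\<^sub>m m"
  have car: "F x \<in> carrier_mat n n" "?U \<in> carrier_mat n n" "?V \<in> carrier_mat n n" for x
    using F by (auto simp: circulant_carrier Omega_def Omega_inv_def mat_diag_power)
  \<comment> \<open>The trailing factor \<open>M\<close> lets these rules act inside a product
    associated to the right.\<close>
  have U: "?U * (?E * M) = char_mat n m * M" and V: "?V * (char_mat n m * M) = ?E * M"
    and D: "F y * (char_mat n k * M) = char_mat n k * (?D y k * M)"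
    if "M \<in> carrier_mat n n" for M y k
    using that car F
    by (simp_all add: Omega_power_mult_char_mat Omega_inv_power_mult_char_mat circulant_mult_char_mat
        flip: assoc_mult_mat[of _ n n _ n _ n])
  have "F y * ?E = ?E * ?D y 0" for y
    using F by (simp add: circulant_mult_char_mat)
  then have rhs: "?V * F y * ?U * F x * ?E = ?E * (?D y m * ?D x 0)" for x y
    using car by (simp add: U V D assoc_mult_mat[of _ n n _ n _ n] mult_carrier_mat[of _ n n _ n])
  have "F z = ?V * F y * ?U * F x \<longleftrightarrow>
      (\<forall>p. circ_eig n (F z) p = circ_eig n (F y) (p + m) * circ_eig n (F x) p)" for x y z
  proof -
    have "F z = ?V * F y * ?U * F x \<longleftrightarrow> F z * ?E = ?V * F y * ?U * F x * ?E"
      using car n char_mat_cancel_right[of "F z" n "?V * F y * ?U * F x"]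
        mult_carrier_mat[of _ n n _ n] by metis
    also have "\<dots> \<longleftrightarrow> ?E * ?D z 0 = ?E * (?D y m * ?D x 0)"
      using circulant_mult_char_mat[of n "F z" 0] F by (simp add: rhs)
    also have "\<dots> \<longleftrightarrow> ?D z 0 = ?D y m * ?D x 0"
      using n char_mat_cancel_left[of "?D z 0" n "?D y m * ?D x 0"] by auto
    also have "\<dots> \<longleftrightarrow> (\<forall>p<n. circ_eig n (F z) p = circ_eig n (F y) (p + m) * circ_eig n (F x) p)"
      by (simp add: mat_diag_diag mat_diag_eq_iff)
    \<comment> \<open>\<open>circ_eig\<close> depends on its index only modulo \<open>n\<close>, so
      the equations for \<open>p < n\<close> yield all others.\<close>
    also have "\<dots> \<longleftrightarrow> (\<forall>p. circ_eig n (F z) p = circ_eig n (F y) (p + m) * circ_eig n (F x) p)"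
      using n by (metis circ_eig_mod mod_add_left_eq mod_less_divisor)
    finally show ?thesis .
  qed
  then show ?thesis
    unfolding satisfies_equation_def by simp
qed

section \<open>First rows with prescribed eigenvalues\<close>

lemma circ_eig_circ_eq_char_mat:
  assumes "a \<in> carrier_vec n" "p < n"
  shows "circ_eig n (circ a) p = (char_mat n 0 *\<^sub>v a) $ p"
  using assms
  by (auto simp: circ_eig_circ char_mat_def scalar_prod_def atLeast0LessThan mult.commute
      intro!: sum.cong)

text \<open>The factor \<open>1 / sqrt n\<close> compensates the \<open>sqrt n\<close> in the
  product of \<open>char_mat n 0\<close> and \<open>fourier_mat n\<close>, so the column fed to the
  Fourier matrix comes back as the spectrum.\<close>

lemma circ_eig_circ_fourier_mat:
  assumes "v \<in> carrier_vec n" "p < n"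
  shows "circ_eig n (circ (complex_of_real (1 / sqrt (real n)) \<cdot>\<^sub>v (fourier_mat n *\<^sub>v v))) p = v $ p"
proof -
  let ?c = "complex_of_real (1 / sqrt (real n))"
  let ?a = "?c \<cdot>\<^sub>v (fourier_mat n *\<^sub>v v)"
  have Wv: "fourier_mat n *\<^sub>v v \<in> carrier_vec n"
    by (rule mult_mat_vec_carrier[OF fourier_mat_carrier assms(1)])
  then have a: "?a \<in> carrier_vec n" by simp
  have "circ_eig n (circ ?a) p = (char_mat n 0 *\<^sub>v ?a) $ p"
    by (rule circ_eig_circ_eq_char_mat[OF a assms(2)])
  also have "char_mat n 0 *\<^sub>v ?a = ?c \<cdot>\<^sub>v (char_mat n 0 * fourier_mat n *\<^sub>v v)"
    using assms(1) Wv
    by (simp only: mult_mat_vec[OF char_mat_carrier Wv]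
        assoc_mult_mat_vec[OF char_mat_carrier fourier_mat_carrier assms(1)])
  also have "\<dots> = v"
    using assms by (auto simp: char_mat_mult_fourier_mat mult_mat_vec_def intro!: eq_vecI)
  finally show ?thesis .
qed

lemma circulant_eq_circ_fourier_mat_iff:
  assumes "circulant n A" "v \<in> carrier_vec n" "n > 0"
  shows "A = circ (complex_of_real (1 / sqrt (real n)) \<cdot>\<^sub>v (fourier_mat n *\<^sub>v v)) \<longleftrightarrow>
    (\<forall>p<n. circ_eig n A p = v $ p)"
proof -
  have "circulant n (circ (complex_of_real (1 / sqrt (real n)) \<cdot>\<^sub>v (fourier_mat n *\<^sub>v v)))"
    using assms(2) by (intro circulant_circ) (simp add: mult_mat_vec_carrier[OF fourier_mat_carrier])
  then show ?thesis
    using assms circ_eig_circ_fourier_mat[OF assms(2)] by (auto intro!: circulant_eqI)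
qed

lemma circulant_eq_circ_first_row_iff:
  assumes "circulant n A" "d dvd n" "n > 0"
  shows "A = circ (first_row n d c h x) \<longleftrightarrow>
    (\<forall>p<n. circ_eig n A p = h (p mod d) (c ^ (p div d) * x))"
proof -
  let ?v = "stack (n div d) d (\<lambda>j. vec d (\<lambda>i. h i (c ^ j * x)))"
  have d: "d > 0" and nd: "n div d * d = n"
    using assms by (auto intro: Nat.gr0I)
  then have "?v \<in> carrier_vec n" and "\<forall>p<n. ?v $ p = h (p mod d) (c ^ (p div d) * x)"
    by (simp_all add: stack_def)
  then show ?thesis
    using circulant_eq_circ_fourier_mat_iff[OF assms(1), of ?v] assms(3)
    unfolding first_row_def by simp
qed

section \<open>The coupled scalar equations\<close>

lemma coupled_exponential_iff:
  fixes L :: "nat \<Rightarrow> complex \<Rightarrow> complex" and w :: complex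
  assumes n: "n > 0" and w: "w ^ n = 1" and per: "\<And>p. L (p + n) = L p" and d: "d = gcd n m"
  shows "(\<forall>x y p. L p (x + w ^ m * y) = L (p + m) y * L p x) \<longleftrightarrow>
    (\<exists>h. (\<forall>i<d. exponential_function (h i)) \<and>
      (\<forall>x. \<forall>p<n. L p x = h (p mod d) ((w ^ d) ^ (p div d) * x)))"
    (is "?eqn \<longleftrightarrow> ?sol")
proof
  have w0: "w \<noteq> 0" using w n by (auto simp: power_0_left)
  have per_mult: "L (p + n * k) = L p" for p k
  proof (induction k)
    case (Suc k)
    then show ?case using per[of "p + n * k"] by (simp add: add_ac)
  qed simp
  {
    assume eqn: ?eqn
    have nonzero_shift: "L (p + m) 0 = 1" if "L p x \<noteq> 0" for p x
      using eqn[rule_format, of p x 0] that by simp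
    have nonzero_iterate: "\<exists>y. L (p + k * m) y \<noteq> 0" if "L p x \<noteq> 0" for p k x
    proof (induction k)
      case 0
      show ?case using that by auto
    next
      case (Suc k)
      then obtain y where "L (p + k * m) y \<noteq> 0" by blast
      then have "L (p + Suc k * m) 0 = 1"
        using nonzero_shift[of "p + k * m" y] by (simp add: add_ac)
      then show ?case by (metis zero_neq_one)
    qed
    \<comment> \<open>From \<open>p + m\<close>, another \<open>n - 1\<close> steps of length
      \<open>m\<close> reach \<open>p + n * m\<close>, where \<open>L\<close> is \<open>L p\<close>
      again by periodicity: the cycle closes.\<close>
    have cycle: "p + m + (n - 1) * m = p + n * m" "p + (n - 1) * m + m = p + n * m" for p
      using n by (cases n; simp)+
    have shift: "L (p + m) y = L p (w ^ m * y)" for p y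
    proof (cases "\<exists>x. L p x \<noteq> 0")
      case True
      then obtain x where "L p x \<noteq> 0" by blast
      from nonzero_iterate[OF this, of "n - 1"] obtain z where "L (p + (n - 1) * m) z \<noteq> 0"
        by blast
      from nonzero_shift[OF this] have "L p 0 = 1"
        by (simp only: cycle per_mult)
      then show ?thesis using eqn[rule_format, of p 0 y] by simp
    next
      \<comment> \<open>A nonzero value of \<open>L (p + m)\<close> would travel around the cycle
        and make \<open>L p\<close> nonzero somewhere.\<close>
      case False
      then have "L (p + m) y = 0"
        using nonzero_iterate[of "p + m" y "n - 1"] by (auto simp only: cycle per_mult)
      then show ?thesis using False by simp
    qed
    have exp: "exponential_function (L p)" for p
      unfolding exponential_function_def
    proof (intro allI)
      fix x z
      \<comment> \<open>Take \<open>y = z / w ^ m\<close>; the factor \<open>L (p + m) y\<close> is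
        then \<open>L p z\<close> by \<open>shift\<close>.\<close>
      show "L p (x + z) = L p x * L p z"
        using eqn[rule_format, of p x "z / w ^ m"] w0 by (simp add: shift mult.commute)
    qed
    have shift_iterate: "L (p + m * k) y = L p (w ^ (m * k) * y)" for p k y
    proof (induction k arbitrary: y)
      case (Suc k)
      have "L (p + m * Suc k) y = L (p + m * k) (w ^ m * y)"
        using shift[of "p + m * k" y] by (simp add: add_ac)
      also have "\<dots> = L p (w ^ (m * k) * (w ^ m * y))" by (rule Suc)
      finally show ?case by (simp add: power_add mult_ac)
    qed simp
    \<comment> \<open>Bezout in a form with natural coefficients: \<open>d\<close> forward steps
      equal \<open>m * b\<close> backward steps modulo \<open>n\<close>.\<close>
    obtain a b where ab: "n * a = m * b + d"
      using bezout_nat[of n m] n d by auto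
    have shift_d: "L (p + d) y = L p (w ^ d * y)" for p y
    proof -
      have "w ^ (m * b) * w ^ d = 1"
        using w ab by (metis power_add power_mult power_one)
      \<comment> \<open>The argument is multiplied by \<open>w ^ (m * b) * w ^ d = 1\<close>;
        \<open>shift_iterate\<close> read backwards then trades \<open>w ^ (m * b)\<close> for an
        index shift, giving the total index \<open>p + n * a\<close>.\<close>
      then have "L (p + d) y = L (p + d) (w ^ (m * b) * (w ^ d * y))"
        by (simp flip: mult.assoc)
      also have "\<dots> = L (p + n * a) (w ^ d * y)"
        by (simp add: ab add_ac flip: shift_iterate)
      finally show ?thesis by (simp add: per_mult)
    qed
    have "L (i + d * k) y = L i ((w ^ d) ^ k * y)" for i k y
    proof (induction k arbitrary: y)
      case (Suc k)
      have "L (i + d * Suc k) y = L (i + d * k) (w ^ d * y)"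
        using shift_d[of "i + d * k" y] by (simp add: add_ac)
      also have "\<dots> = L i ((w ^ d) ^ k * (w ^ d * y))" by (rule Suc)
      finally show ?case by (simp add: mult_ac)
    qed simp
    then have "L p x = L (p mod d) ((w ^ d) ^ (p div d) * x)" for p x
      by (metis mod_mult_div_eq)
    then show ?sol using exp by blast
  }
  assume ?sol
  then obtain h where h: "\<And>i. i < d \<Longrightarrow> exponential_function (h i)"
    and L: "\<And>p x. p < n \<Longrightarrow> L p x = h (p mod d) (w ^ (d * (p div d)) * x)"
    by (auto simp: power_mult)
  have dn: "d dvd n" and dm: "d dvd m" and d0: "d > 0" using d n by auto
  \<comment> \<open>The equation involves \<open>p + m\<close>, which may reach beyond
    \<open>n - 1\<close>, so the formula is first extended to all indices. Both powers of
    \<open>w\<close> become \<open>w ^ p\<close> after multiplication by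
    \<open>w ^ (p mod d)\<close>.\<close>
  have L_all: "L p x = h (p mod d) (w ^ (d * (p div d)) * x)" for p x
  proof -
    have mod_d: "p mod n mod d = p mod d" using dn by (rule mod_mod_cancel)
    have "w ^ (d * (p mod n div d)) * w ^ (p mod d) = w ^ (p mod n)"
      by (metis mod_d mult_div_mod_eq power_add)
    also have "\<dots> = w ^ p"
      using w by (metis mult_div_mod_eq power_add power_mult power_one mult_1)
    also have "\<dots> = w ^ (d * (p div d)) * w ^ (p mod d)"
      by (metis mult_div_mod_eq power_add)
    finally have "w ^ (d * (p mod n div d)) = w ^ (d * (p div d))"
      using w0 by simp
    moreover have "L p = L (p mod n)"
      using per_mult[of "p mod n" "p div n"] by simp
    ultimately show ?thesis
      using L[of "p mod n" x] n by (simp add: mod_d)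
  qed
  have "L p (x + w ^ m * y) = L (p + m) y * L p x" for x y p
  proof -
    \<comment> \<open>As \<open>d\<close> divides \<open>m\<close>, moving from \<open>p\<close> to
      \<open>p + m\<close> keeps the same \<open>h\<close> and multiplies its argument by exactly
      \<open>w ^ m\<close>.\<close>
    have "d * ((p + m) div d) = d * (p div d) + m" "(p + m) mod d = p mod d"
      using dm d0 by (auto simp: distrib_left)
    moreover have "exponential_function (h (p mod d))" using h d0 by simp
    ultimately show ?thesis
      by (simp add: L_all exponential_function_def algebra_simps power_add)
  qed
  then show ?eqn by blast
qed

section \<open>Assembly of the three characterisations\<close>

theorem theorem3p1:
  fixes n m d :: nat and F :: "complex \<Rightarrow> complex mat"
  assumes "n \<ge> 2" and "m < n" and "d = gcd n m"
    and "\<forall>x. circulant n (F x)"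
  shows "(satisfies_equation n m F \<longleftrightarrow>
           (\<exists>h. (\<forall>i<d. exponential_function (h i)) \<and>
                (\<forall>x. F x = circ (first_row n d (omega n ^ d) h x))))
       \<and> (m = 0 \<or> m dvd n \<longrightarrow>
           (satisfies_equation n m F \<longleftrightarrow>
             (\<exists>h. (\<forall>i<d. exponential_function (h i)) \<and>
                  (\<forall>x. F x = circ (first_row n d (omega n ^ m) h x)))))
       \<and> (d = 1 \<longrightarrow>
           (satisfies_equation n m F \<longleftrightarrow>
             (\<exists>g. exponential_function g \<and>
                  (\<forall>x. F x = circ (complex_of_real (1 / sqrt (real n)) \<cdot>\<^sub>v
                         (fourier_mat n *\<^sub>v vec n (\<lambda>j. g (omega n ^ j * x))))))))"
proof -
  have n: "n > 0" and dn: "d dvd n" using assms by auto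
  have circ_F: "circulant n (F x)" for x using assms(4) by simp
  let ?L = "\<lambda>p x. circ_eig n (F x) p"
  have main: "satisfies_equation n m F \<longleftrightarrow>
      (\<exists>h. (\<forall>i<d. exponential_function (h i)) \<and>
        (\<forall>x. \<forall>p<n. ?L p x = h (p mod d) ((omega n ^ d) ^ (p div d) * x)))"
    unfolding satisfies_equation_iff_circ_eig[OF n assms(4)]
    by (rule coupled_exponential_iff[where L = ?L]) (use n assms(3) in simp_all)
  then have general: "satisfies_equation n m F \<longleftrightarrow>
      (\<exists>h. (\<forall>i<d. exponential_function (h i)) \<and>
        (\<forall>x. F x = circ (first_row n d (omega n ^ d) h x)))"
    by (simp add: circulant_eq_circ_first_row_iff[OF circ_F dn n])
  \<comment> \<open>If \<open>m\<close> is a positive divisor of \<open>n\<close>, then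
    \<open>d = m\<close>; if \<open>m = 0\<close>, then \<open>d = n\<close> and both powers are
    1.\<close>
  moreover have "omega n ^ m = omega n ^ d" if "m = 0 \<or> m dvd n"
    using that n assms(3) by (auto simp: gcd_nat.absorb2)
  moreover have "satisfies_equation n m F \<longleftrightarrow>
      (\<exists>g. exponential_function g \<and>
        (\<forall>x. F x = circ (complex_of_real (1 / sqrt (real n)) \<cdot>\<^sub>v
           (fourier_mat n *\<^sub>v vec n (\<lambda>j. g (omega n ^ j * x))))))" if "d = 1"
  proof -
    have "satisfies_equation n m F \<longleftrightarrow>
        (\<exists>g. exponential_function g \<and> (\<forall>x. \<forall>p<n. ?L p x = g (omega n ^ p * x)))"
      (is "_ \<longleftrightarrow> (\<exists>g. ?P g)")
    proof -
      \<comment> \<open>For \<open>d = 1\<close> only \<open>h 0\<close> occurs, so a family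
        \<open>h\<close> carries the same information as a single \<open>g\<close>.\<close>
      have "(\<exists>h :: nat \<Rightarrow> complex \<Rightarrow> complex. ?P (h 0)) \<longleftrightarrow> (\<exists>g. ?P g)"
      proof
        assume "\<exists>g. ?P g"
        then obtain g where "?P g" ..
        then show "\<exists>h :: nat \<Rightarrow> complex \<Rightarrow> complex. ?P (h 0)"
          by (intro exI[of _ "\<lambda>_. g"])
      qed blast
      then show ?thesis unfolding main using that by simp
    qed
    then show ?thesis
      by (simp only: circulant_eq_circ_fourier_mat_iff[OF circ_F vec_carrier n]) simp
  qed
  ultimately show ?thesis by simp
qed

end
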